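(* Let $(\mathscr{G},\{\cdot_\lambda\}_{\lambda\in\Lambda},\{\vartriangleright_\lambda\}_{\lambda\in\Lambda})$ be a dynamical post-group, $\mathscr{G}=(G,\Lambda,\phi_G)$. Then $(\mathscr{G}_\rhd,R_G)$ is a braided dynamical group, where $\mathscr{G}_\rhd=(G,\Lambda,\phi_G,\{\circ_\lambda\}_{\lambda\in\Lambda})$ is the sub-adjacent dynamical group, $a\circ_\lambda b=a\cdot_\lambda(a\vartriangleright_\lambda b)$, and $R_G:\Lambda\times G\times G\to G\times G$ is $$R_G(\lambda,a,b)=\Big(a\vartriangleright_\lambda b,\ \overline{(a\vartriangleright_\lambda b)}^{\lambda}\circ_{\phi_G(\lambda,a\vartriangleright_\lambda b)}(a\circ_\lambda b)\Big),\quad\lambda\in\Lambda,\ a,b\in G,$$ with $\bar c^\lambda$ the inverse of $c$ with respect to $\circ_\lambda$ in $\mathscr{G}_\rhd$. Moreover, if $\Psi$ is a homomorphism of dynamical post-groups from $(\mathscr{G},\{\cdot_\lambda\},\{\vartriangleright_\lambda\})$ to $(\mathscr{H},\{\cdot'_\lambda\},\{\vartriangleright'_\lambda\})$, then $\Psi$ is a homomorphism of braided dynamical groups from $(\mathscr{G}_\rhd,R_G)$ to $(\mathscr{H}_{\rhd'},R_H)$.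
   Context: Fix a set $\Lambda$. A dynamical set is a triple $\mathscr{X}=(X,\Lambda,\phi_X)$ with $X$ a set and $\phi_X:\Lambda\times X\to\Lambda$ a map. A morphism $\mathscr{X}\to\mathscr{Y}$ is a map $f:\Lambda\times X\to Y$, $f_\lambda=f(\lambda,-)$, with $\phi_Y(\lambda,f_\lambda(x))=\phi_X(\lambda,x)$. The tensor product is $\mathscr{X}\otimes\mathscr{Y}=(X\times Y,\Lambda,\phi_{X\times Y})$, $\phi_{X\times Y}(\lambda,x,y)=\phi_Y(\phi_X(\lambda,x),y)$. Dynamical group: a dynamical set $\mathscr{G}=(G,\Lambda,\phi_G)$ with maps $\circ_\lambda:G\times G\to G$ such that $\phi_G(\lambda,a\circ_\lambda b)=\phi_G(\phi_G(\lambda,a),b)$ and $a\circ_\lambda(b\circ_{\phi_G(\lambda,a)}c)=(a\circ_\lambda b)\circ_\lambda c$; an element $e_G$ with $a\circ_\lambda e_G=e_G\circ_\lambda a=a$ and $\phi_G(\lambda,e_G)=\lambda$; and for all $\lambda,a$ a (unique) element $\bar a^\lambda$ with $a\circ_\lambda\bar a^\lambda=\bar a^\lambda\circ_{\phi_G(\lambda,a)}a=e_G$. A homomorphism of dynamical groups $(\mathscr{G},\circ)\to(\mathscr{H},\circ')$ is a morphism of dynamical sets $\Psi$ with $\Psi_\lambda(a\circ_\lambda b)=\Psi_\lambda(a)\circ'_\lambda\Psi_{\phi_G(\lambda,a)}(b)$. A constant dynamical group is a dynamical group whose structure map is $(\lambda,x)\mapsto\lambda$, i.e. a family of group structures $\cdot_\lambda$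 ($\lambda\in\Lambda$) on one set with a common unit; $a^\lambda$ denotes the inverse of $a$ for $\cdot_\lambda$. Dynamical post-group: a dynamical set $\mathscr{G}=(G,\Lambda,\phi_G)$ with maps $\cdot_\lambda,\vartriangleright_\lambda:G\times G\to G$ ($\lambda\in\Lambda$) such that $(G,\Lambda,\{\cdot_\lambda\})$ is a constant dynamical group, with unit $e_G$; and for all $\lambda\in\Lambda$, $a,b,c\in G$: $a\vartriangleright_\lambda(b\cdot_{\phi_G(\lambda,a)}c)=(a\vartriangleright_\lambda b)\cdot_\lambda(a\vartriangleright_\lambda c)$; $(a\cdot_\lambda(a\vartriangleright_\lambda b))\vartriangleright_\lambda c=a\vartriangleright_\lambda(b\vartriangleright_{\phi_G(\lambda,a)}c)$; and the map $L^{\rhd_\lambda}_a:G\to G$, $b\mapsto a\vartriangleright_\lambda b$, is invertible. Its sub-adjacent dynamical group $\mathscr{G}_\rhd$ is $(G,\Lambda,\phi_G,\{\circ_\lambda\})$ with $a\circ_\lambda b=a\cdot_\lambda(a\vartriangleright_\lambda b)$, unit $e_G$ and inverses $\bar a^\lambda=(L^{\rhd_\lambda}_a)^{-1}(a^\lambda)$. A homomorphism of dynamical post-groups is a morphism of dynamical sets $\Psi:\mathscr{G}\to\mathscr{H}$ with $\Psi_\lambda(a\cdot_\lambda b)=\Psi_\lambda(a)\cdot'_\lambda\Psi_\lambda(b)$ and $\Psi_\lambda(a\vartriangleright_\lambda b)=\Psi_\lambda(a)\vartriangleright'_\lambda\Psi_{\phi_G(\lambda,a)}(b)$. Braided dynamical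 group $(\mathscr{G},\sigma)$: a dynamical group $(\mathscr{G},\circ)$ with a map $\sigma:\Lambda\times G\times G\to G\times G$, $\sigma(\lambda,a,b)=(a\rightharpoonup_\lambda b,\ a\leftharpoonup_\lambda b)$, which is a morphism of dynamical sets $\mathscr{G}\otimes\mathscr{G}\to\mathscr{G}\otimes\mathscr{G}$ such that for all $\lambda\in\Lambda$, $a,b,x,y\in G$: (1) $e_G\rightharpoonup_\lambda x=x$; (2) $(a\circ_\lambda b)\rightharpoonup_\lambda x=a\rightharpoonup_\lambda(b\rightharpoonup_{\phi_G(\lambda,a)}x)$; (3) $a\rightharpoonup_\lambda(x\circ_{\phi_G(\lambda,a)}y)=(a\rightharpoonup_\lambda x)\circ_\lambda\big((a\leftharpoonup_\lambda x)\rightharpoonup_{\phi_G(\lambda,a\rightharpoonup_\lambda x)}y\big)$; (4) $a\leftharpoonup_\lambda e_G=a$; (5) $a\leftharpoonup_\lambda(x\circ_{\phi_G(\lambda,a)}y)=(a\leftharpoonup_\lambda x)\leftharpoonup_{\phi_G(\lambda,a\rightharpoonup_\lambda x)}y$; (6) $(a\circ_\lambda b)\leftharpoonup_\lambda x=\big(a\leftharpoonup_\lambda(b\rightharpoonup_{\phi_G(\lambda,a)}x)\big)\circ_{\phi_G(\lambda,(a\circ_\lambda b)\rightharpoonup_\lambda x)}(b\leftharpoonup_{\phi_G(\lambda,a)}x)$; (7) $(a\rightharpoonup_\lambda b)\circ_\lambda(a\leftharpoonup_\lambda b)=a\circ_\lambda b$. A homomorphism of braided dynamical groups $(\mathscr{G},\sigma)\to(\mathscr{H},\sigma')$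 is a homomorphism of dynamical groups $\Psi$ with $(\Psi\times\Psi)_\lambda\circ\sigma_\lambda=\sigma'_\lambda\circ(\Psi\times\Psi)_\lambda$ for all $\lambda$, where $(\Psi\times\Psi)_\lambda(a,b)=(\Psi_\lambda(a),\Psi_{\phi_G(\lambda,a)}(b))$.
   Formalization: For G (and for H in the second part) it is additionally assumed that φ(λ,a∘_λ b)=φ(φ(λ,a),b) and φ(λ,e)=λ; these are part of the conclusion but do not follow from the dynamical post-group axioms as stated. *)

theory Defs
  imports Main
begin

text \<open>
  All structures live on explicit carrier sets \<open>\<Lambda>\<close>, \<open>G\<close>, \<open>H\<close>, which may be proper subsets of
  their types; a map such as \<open>\<Lambda> \<times> G \<rightarrow> \<Lambda>\<close> is a HOL function constrained on the carriers only.
  The parameter in \<open>\<Lambda>\<close> is always the first argument, so \<open>circ l a b\<close> is \<open>a \<circ>\<^sub>l b\<close> and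
  \<open>\<Psi> l a\<close> is \<open>\<Psi>\<^sub>l(a)\<close>.
\<close>

locale dynamical_set =
  fixes \<Lambda> :: "'l set" and X :: "'x set" and \<phi> :: "'l \<Rightarrow> 'x \<Rightarrow> 'l"
  assumes structure_map_closed: "\<And>l x. \<lbrakk>l \<in> \<Lambda>; x \<in> X\<rbrakk> \<Longrightarrow> \<phi> l x \<in> \<Lambda>"

locale dynamical_set_morphism =
  source: dynamical_set \<Lambda> X \<phi>\<^sub>X + target: dynamical_set \<Lambda> Y \<phi>\<^sub>Y
  for \<Lambda> :: "'l set"
    and X :: "'x set" and \<phi>\<^sub>X :: "'l \<Rightarrow> 'x \<Rightarrow> 'l"
    and Y :: "'y set" and \<phi>\<^sub>Y :: "'l \<Rightarrow> 'y \<Rightarrow> 'l" +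
  fixes f :: "'l \<Rightarrow> 'x \<Rightarrow> 'y"
  assumes morphism_closed: "\<And>l x. \<lbrakk>l \<in> \<Lambda>; x \<in> X\<rbrakk> \<Longrightarrow> f l x \<in> Y"
    and morphism_structure_map: "\<And>l x. \<lbrakk>l \<in> \<Lambda>; x \<in> X\<rbrakk> \<Longrightarrow> \<phi>\<^sub>Y l (f l x) = \<phi>\<^sub>X l x"

definition tensor_structure_map ::
    "('l \<Rightarrow> 'x \<Rightarrow> 'l) \<Rightarrow> ('l \<Rightarrow> 'y \<Rightarrow> 'l) \<Rightarrow> 'l \<Rightarrow> 'x \<times> 'y \<Rightarrow> 'l" where
  "tensor_structure_map \<phi>\<^sub>X \<phi>\<^sub>Y l = (\<lambda>(x, y). \<phi>\<^sub>Y (\<phi>\<^sub>X l x) y)"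

locale dynamical_group = dynamical_set \<Lambda> G \<phi>
  for \<Lambda> :: "'l set" and G :: "'g set" and \<phi> :: "'l \<Rightarrow> 'g \<Rightarrow> 'l" +
  fixes circ :: "'l \<Rightarrow> 'g \<Rightarrow> 'g \<Rightarrow> 'g" and e :: 'g
  assumes circ_closed: "\<And>l a b. \<lbrakk>l \<in> \<Lambda>; a \<in> G; b \<in> G\<rbrakk> \<Longrightarrow> circ l a b \<in> G"
    and structure_map_circ:
      "\<And>l a b. \<lbrakk>l \<in> \<Lambda>; a \<in> G; b \<in> G\<rbrakk> \<Longrightarrow> \<phi> l (circ l a b) = \<phi> (\<phi> l a) b"
    and circ_assoc:
      "\<And>l a b c. \<lbrakk>l \<in> \<Lambda>; a \<in> G; b \<in> G; c \<in> G\<rbrakk>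
        \<Longrightarrow> circ l a (circ (\<phi> l a) b c) = circ l (circ l a b) c"
    and unit_closed: "e \<in> G"
    and circ_unit_right: "\<And>l a. \<lbrakk>l \<in> \<Lambda>; a \<in> G\<rbrakk> \<Longrightarrow> circ l a e = a"
    and circ_unit_left: "\<And>l a. \<lbrakk>l \<in> \<Lambda>; a \<in> G\<rbrakk> \<Longrightarrow> circ l e a = a"
    and structure_map_unit: "\<And>l. l \<in> \<Lambda> \<Longrightarrow> \<phi> l e = l"
    and inverse_ex1:
      "\<And>l a. \<lbrakk>l \<in> \<Lambda>; a \<in> G\<rbrakk> \<Longrightarrow> \<exists>!b. b \<in> G \<and> circ l a b = e \<and> circ (\<phi> l a) b a = e"

definition dynamical_inverse ::
    "'g set \<Rightarrow> ('l \<Rightarrow> 'g \<Rightarrow> 'l) \<Rightarrow> ('l \<Rightarrow> 'g \<Rightarrow> 'g \<Rightarrow> 'g) \<Rightarrow> 'g \<Rightarrow> 'l \<Rightarrow> 'g \<Rightarrow> 'g" where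
  "dynamical_inverse G \<phi> circ e l a =
     (THE b. b \<in> G \<and> circ l a b = e \<and> circ (\<phi> l a) b a = e)"

locale dynamical_group_hom =
  source: dynamical_group \<Lambda> G \<phi> circ e + target: dynamical_group \<Lambda> H \<phi>' circ' e' +
  dynamical_set_morphism \<Lambda> G \<phi> H \<phi>' \<Psi>
  for \<Lambda> :: "'l set"
    and G :: "'g set" and \<phi> and circ and e
    and H :: "'h set" and \<phi>' and circ' and e'
    and \<Psi> :: "'l \<Rightarrow> 'g \<Rightarrow> 'h" +
  assumes hom_circ:
    "\<And>l a b. \<lbrakk>l \<in> \<Lambda>; a \<in> G; b \<in> G\<rbrakk> \<Longrightarrow> \<Psi> l (circ l a b) = circ' l (\<Psi> l a) (\<Psi> (\<phi> l a) b)"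

locale constant_dynamical_group = dynamical_group \<Lambda> G "\<lambda>l x. l" dot e
  for \<Lambda> :: "'l set" and G :: "'g set" and dot :: "'l \<Rightarrow> 'g \<Rightarrow> 'g \<Rightarrow> 'g" and e :: 'g

locale dynamical_post_group =
  dynamical_set \<Lambda> G \<phi> + const: constant_dynamical_group \<Lambda> G dot e
  for \<Lambda> :: "'l set" and G :: "'g set" and \<phi> :: "'l \<Rightarrow> 'g \<Rightarrow> 'l"
    and dot :: "'l \<Rightarrow> 'g \<Rightarrow> 'g \<Rightarrow> 'g" and e :: 'g +
  fixes tri :: "'l \<Rightarrow> 'g \<Rightarrow> 'g \<Rightarrow> 'g"
  assumes tri_closed: "\<And>l a b. \<lbrakk>l \<in> \<Lambda>; a \<in> G; b \<in> G\<rbrakk> \<Longrightarrow> tri l a b \<in> G"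
    and tri_dot:
      "\<And>l a b c. \<lbrakk>l \<in> \<Lambda>; a \<in> G; b \<in> G; c \<in> G\<rbrakk>
        \<Longrightarrow> tri l a (dot (\<phi> l a) b c) = dot l (tri l a b) (tri l a c)"
    and tri_weighted_assoc:
      "\<And>l a b c. \<lbrakk>l \<in> \<Lambda>; a \<in> G; b \<in> G; c \<in> G\<rbrakk>
        \<Longrightarrow> tri l (dot l a (tri l a b)) c = tri l a (tri (\<phi> l a) b c)"
    and tri_invertible: "\<And>l a. \<lbrakk>l \<in> \<Lambda>; a \<in> G\<rbrakk> \<Longrightarrow> bij_betw (tri l a) G G"

definition sub_adjacent ::
    "('l \<Rightarrow> 'g \<Rightarrow> 'g \<Rightarrow> 'g) \<Rightarrow> ('l \<Rightarrow> 'g \<Rightarrow> 'g \<Rightarrow> 'g) \<Rightarrow> 'l \<Rightarrow> 'g \<Rightarrow> 'g \<Rightarrow> 'g" where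
  "sub_adjacent dot tri l a b = dot l a (tri l a b)"

text \<open>
  The two conditions a dynamical group puts on its structure map. For the sub-adjacent
  operation they are not consequences of the axioms in \<open>dynamical_post_group\<close>, and neither
  implies the other (see the two examples below), although they are part of the assertion that
  the sub-adjacent structure is a dynamical group.
\<close>

definition structure_map_compatible ::
    "'l set \<Rightarrow> 'g set \<Rightarrow> ('l \<Rightarrow> 'g \<Rightarrow> 'l) \<Rightarrow> ('l \<Rightarrow> 'g \<Rightarrow> 'g \<Rightarrow> 'g) \<Rightarrow> 'g \<Rightarrow> bool" where
  "structure_map_compatible \<Lambda> G \<phi> circ e \<longleftrightarrow>
     (\<forall>l\<in>\<Lambda>. \<forall>a\<in>G. \<forall>b\<in>G. \<phi> l (circ l a b) = \<phi> (\<phi> l a) b) \<and> (\<forall>l\<in>\<Lambda>. \<phi> l e = l)"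

lemma structure_map_unit_not_automatic:
  defines "\<phi> \<equiv> \<lambda>(l::bool) (a::unit). False"
    and "dot \<equiv> \<lambda>(l::bool) (a::unit) (b::unit). ()"
    and "tri \<equiv> \<lambda>(l::bool) (a::unit) (b::unit). ()"
  shows "dynamical_post_group UNIV UNIV \<phi> dot () tri"
    and "\<forall>l a b. \<phi> l (sub_adjacent dot tri l a b) = \<phi> (\<phi> l a) b"
    and "\<phi> True () \<noteq> True"
  unfolding \<phi>_def dot_def tri_def
  by (unfold_locales, auto simp: bij_betw_def inj_on_def)

lemma structure_map_circ_not_automatic:
  defines "\<phi> \<equiv> \<lambda>l a::bool. l \<and> \<not> a"
    and "dot \<equiv> \<lambda>(l::bool) (a::bool) (b::bool). a \<noteq> b"
    and "tri \<equiv> \<lambda>(l::bool) (a::bool) (b::bool). b"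
  shows "dynamical_post_group UNIV UNIV \<phi> dot False tri"
    and "\<forall>l. \<phi> l False = l"
    and "\<phi> True (sub_adjacent dot tri True True True) \<noteq> \<phi> (\<phi> True True) True"
  unfolding \<phi>_def dot_def tri_def sub_adjacent_def
  by (unfold_locales, auto simp: bij_betw_def)

locale dynamical_post_group_hom =
  source: dynamical_post_group \<Lambda> G \<phi> dot e tri +
  target: dynamical_post_group \<Lambda> H \<phi>' dot' e' tri' +
  dynamical_set_morphism \<Lambda> G \<phi> H \<phi>' \<Psi>
  for \<Lambda> :: "'l set"
    and G :: "'g set" and \<phi> and dot and e and tri
    and H :: "'h set" and \<phi>' and dot' and e' and tri'
    and \<Psi> :: "'l \<Rightarrow> 'g \<Rightarrow> 'h" +
  assumes hom_dot:
      "\<And>l a b. \<lbrakk>l \<in> \<Lambda>; a \<in> G; b \<in> G\<rbrakk> \<Longrightarrow> \<Psi> l (dot l a b) = dot' l (\<Psi> l a) (\<Psi> l b)"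
    and hom_tri:
      "\<And>l a b. \<lbrakk>l \<in> \<Lambda>; a \<in> G; b \<in> G\<rbrakk> \<Longrightarrow> \<Psi> l (tri l a b) = tri' l (\<Psi> l a) (\<Psi> (\<phi> l a) b)"

text \<open>\<open>\<sigma>(l, a, b) = (lharp \<sigma> l a b, rharp \<sigma> l a b)\<close>: the left action of \<open>a\<close> on \<open>b\<close> and the right
  action of \<open>b\<close> on \<open>a\<close>.\<close>

abbreviation lharp :: "('l \<Rightarrow> 'g \<times> 'g \<Rightarrow> 'g \<times> 'g) \<Rightarrow> 'l \<Rightarrow> 'g \<Rightarrow> 'g \<Rightarrow> 'g" where
  "lharp \<sigma> l a b \<equiv> fst (\<sigma> l (a, b))"

abbreviation rharp :: "('l \<Rightarrow> 'g \<times> 'g \<Rightarrow> 'g \<times> 'g) \<Rightarrow> 'l \<Rightarrow> 'g \<Rightarrow> 'g \<Rightarrow> 'g" where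
  "rharp \<sigma> l a b \<equiv> snd (\<sigma> l (a, b))"

locale braided_dynamical_group =
  dynamical_group \<Lambda> G \<phi> circ e +
  braiding: dynamical_set_morphism \<Lambda>
    "G \<times> G" "tensor_structure_map \<phi> \<phi>" "G \<times> G" "tensor_structure_map \<phi> \<phi>" \<sigma>
  for \<Lambda> :: "'l set" and G :: "'g set" and \<phi> :: "'l \<Rightarrow> 'g \<Rightarrow> 'l"
    and circ :: "'l \<Rightarrow> 'g \<Rightarrow> 'g \<Rightarrow> 'g" and e :: 'g
    and \<sigma> :: "'l \<Rightarrow> 'g \<times> 'g \<Rightarrow> 'g \<times> 'g" +
  assumes lharp_unit: "\<And>l x. \<lbrakk>l \<in> \<Lambda>; x \<in> G\<rbrakk> \<Longrightarrow> lharp \<sigma> l e x = x"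
    and lharp_circ_left:
      "\<And>l a b x. \<lbrakk>l \<in> \<Lambda>; a \<in> G; b \<in> G; x \<in> G\<rbrakk>
        \<Longrightarrow> lharp \<sigma> l (circ l a b) x = lharp \<sigma> l a (lharp \<sigma> (\<phi> l a) b x)"
    and lharp_circ_right:
      "\<And>l a x y. \<lbrakk>l \<in> \<Lambda>; a \<in> G; x \<in> G; y \<in> G\<rbrakk>
        \<Longrightarrow> lharp \<sigma> l a (circ (\<phi> l a) x y) =
            circ l (lharp \<sigma> l a x) (lharp \<sigma> (\<phi> l (lharp \<sigma> l a x)) (rharp \<sigma> l a x) y)"
    and rharp_unit: "\<And>l a. \<lbrakk>l \<in> \<Lambda>; a \<in> G\<rbrakk> \<Longrightarrow> rharp \<sigma> l a e = a"
    and rharp_circ_right: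
      "\<And>l a x y. \<lbrakk>l \<in> \<Lambda>; a \<in> G; x \<in> G; y \<in> G\<rbrakk>
        \<Longrightarrow> rharp \<sigma> l a (circ (\<phi> l a) x y) =
            rharp \<sigma> (\<phi> l (lharp \<sigma> l a x)) (rharp \<sigma> l a x) y"
    and rharp_circ_left:
      "\<And>l a b x. \<lbrakk>l \<in> \<Lambda>; a \<in> G; b \<in> G; x \<in> G\<rbrakk>
        \<Longrightarrow> rharp \<sigma> l (circ l a b) x =
            circ (\<phi> l (lharp \<sigma> l (circ l a b) x))
              (rharp \<sigma> l a (lharp \<sigma> (\<phi> l a) b x)) (rharp \<sigma> (\<phi> l a) b x)"
    and braided_commutative:
      "\<And>l a b. \<lbrakk>l \<in> \<Lambda>; a \<in> G; b \<in> G\<rbrakk>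
        \<Longrightarrow> circ l (lharp \<sigma> l a b) (rharp \<sigma> l a b) = circ l a b"

definition tensor_square_map ::
    "('l \<Rightarrow> 'g \<Rightarrow> 'l) \<Rightarrow> ('l \<Rightarrow> 'g \<Rightarrow> 'h) \<Rightarrow> 'l \<Rightarrow> 'g \<times> 'g \<Rightarrow> 'h \<times> 'h" where
  "tensor_square_map \<phi> \<Psi> l = (\<lambda>(a, b). (\<Psi> l a, \<Psi> (\<phi> l a) b))"

locale braided_dynamical_group_hom =
  source: braided_dynamical_group \<Lambda> G \<phi> circ e \<sigma> +
  target: braided_dynamical_group \<Lambda> H \<phi>' circ' e' \<sigma>' +
  dynamical_group_hom \<Lambda> G \<phi> circ e H \<phi>' circ' e' \<Psi>
  for \<Lambda> :: "'l set"
    and G :: "'g set" and \<phi> and circ and e and \<sigma>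
    and H :: "'h set" and \<phi>' and circ' and e' and \<sigma>'
    and \<Psi> :: "'l \<Rightarrow> 'g \<Rightarrow> 'h" +
  assumes hom_braiding:
    "\<And>l p. \<lbrakk>l \<in> \<Lambda>; p \<in> G \<times> G\<rbrakk>
      \<Longrightarrow> tensor_square_map \<phi> \<Psi> l (\<sigma> l p) = \<sigma>' l (tensor_square_map \<phi> \<Psi> l p)"

definition post_group_braiding ::
    "'g set \<Rightarrow> ('l \<Rightarrow> 'g \<Rightarrow> 'l) \<Rightarrow> ('l \<Rightarrow> 'g \<Rightarrow> 'g \<Rightarrow> 'g) \<Rightarrow> 'g \<Rightarrow> ('l \<Rightarrow> 'g \<Rightarrow> 'g \<Rightarrow> 'g)
      \<Rightarrow> 'l \<Rightarrow> 'g \<times> 'g \<Rightarrow> 'g \<times> 'g" where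
  "post_group_braiding G \<phi> dot e tri l =
     (\<lambda>(a, b).
        (tri l a b,
         sub_adjacent dot tri (\<phi> l (tri l a b))
           (dynamical_inverse G \<phi> (sub_adjacent dot tri) e l (tri l a b))
           (sub_adjacent dot tri l a b)))"

end

theory Submission
  imports Defs
begin

text \<open>
  The right action \<open>a \<leftharpoonup> b\<close> is the unique solution \<open>r\<close> of \<open>(a \<rhd> b) \<circ> r = a \<circ> b\<close>. Hence every
  identity for the right action, and its compatibility with homomorphisms, is checked after
  composing on the left with a suitable element and cancelling. The identities for the left action
  are the post-group axioms rewritten through \<open>a \<circ> b = a \<cdot> (a \<rhd> b)\<close>.
\<close>

section \<open>Inverses and left cancellation over a moving parameter\<close>

context dynamical_group
begin

lemma dynamical_inverse:
  assumes "l \<in> \<Lambda>" "a \<in> G"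
  shows dynamical_inverse_closed: "dynamical_inverse G \<phi> circ e l a \<in> G"
    and circ_inverse_right: "circ l a (dynamical_inverse G \<phi> circ e l a) = e"
    and circ_inverse_left: "circ (\<phi> l a) (dynamical_inverse G \<phi> circ e l a) a = e"
  using theI'[OF inverse_ex1[OF assms]] unfolding dynamical_inverse_def by auto

text \<open>The inverse \<open>b\<close> of \<open>a\<close> at \<open>l\<close> is composed at the
  parameter \<open>\<phi> l a\<close>, and \<open>\<phi> (\<phi> l a) b = \<phi> l e = l\<close>.
  Associativity at \<open>\<phi> l a\<close> therefore makes composition with \<open>b\<close> a
  left inverse of \<open>circ l a\<close>.\<close>

lemma circ_left_cancel:
  assumes "l \<in> \<Lambda>" "a \<in> G" "x \<in> G" "y \<in> G" and eq: "circ l a x = circ l a y"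
  shows "x = y"
proof -
  define b where "b = dynamical_inverse G \<phi> circ e l a"
  have b: "b \<in> G" "circ l a b = e" "circ (\<phi> l a) b a = e"
    unfolding b_def using dynamical_inverse assms by auto
  have l': "\<phi> l a \<in> \<Lambda>" using structure_map_closed assms by auto
  have source_back: "\<phi> (\<phi> l a) b = l"
    using structure_map_circ[of l a b] structure_map_unit assms b by auto
  have cancel: "circ (\<phi> l a) b (circ l a z) = z" if "z \<in> G" for z
    using circ_assoc[OF l' b(1) assms(2) that, unfolded source_back b(3) circ_unit_left[OF l' that]] .
  show ?thesis using cancel[OF assms(3), unfolded eq] cancel[OF assms(4)] by (rule trans[OF sym])
qed

text \<open>For \<open>c = a \<rhd> b\<close> and \<open>d = a \<circ> b\<close> the solution
  exhibited here is the second component of the braiding.\<close>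

lemma circ_inverse_solves:
  assumes "l \<in> \<Lambda>" "c \<in> G" "d \<in> G"
  shows "circ l c (circ (\<phi> l c) (dynamical_inverse G \<phi> circ e l c) d) = d"
  using assms circ_assoc[of l c "dynamical_inverse G \<phi> circ e l c" d]
    dynamical_inverse[of l c] circ_unit_left by simp

end

text \<open>
  Existence of right inverses suffices: if \<open>a \<circ> b = e\<close> and \<open>b \<circ> c = e\<close>, then
  \<open>a = a \<circ> (b \<circ> c) = c\<close>, where \<open>b \<circ> c\<close> is formed at \<open>\<phi> l a\<close> and \<open>\<phi> (\<phi> l a) b = l\<close>.
\<close>

lemma dynamical_groupI_right_inverse:
  assumes "dynamical_set \<Lambda> G \<phi>"
    and closed: "\<And>l a b. \<lbrakk>l \<in> \<Lambda>; a \<in> G; b \<in> G\<rbrakk> \<Longrightarrow> circ l a b \<in> G"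
    and map: "\<And>l a b. \<lbrakk>l \<in> \<Lambda>; a \<in> G; b \<in> G\<rbrakk> \<Longrightarrow> \<phi> l (circ l a b) = \<phi> (\<phi> l a) b"
    and assoc: "\<And>l a b c. \<lbrakk>l \<in> \<Lambda>; a \<in> G; b \<in> G; c \<in> G\<rbrakk>
        \<Longrightarrow> circ l a (circ (\<phi> l a) b c) = circ l (circ l a b) c"
    and unit: "e \<in> G"
    and right: "\<And>l a. \<lbrakk>l \<in> \<Lambda>; a \<in> G\<rbrakk> \<Longrightarrow> circ l a e = a"
    and left: "\<And>l a. \<lbrakk>l \<in> \<Lambda>; a \<in> G\<rbrakk> \<Longrightarrow> circ l e a = a"
    and map_unit: "\<And>l. l \<in> \<Lambda> \<Longrightarrow> \<phi> l e = l"
    and right_inverse: "\<And>l a. \<lbrakk>l \<in> \<Lambda>; a \<in> G\<rbrakk> \<Longrightarrow> \<exists>b\<in>G. circ l a b = e"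
  shows "dynamical_group \<Lambda> G \<phi> circ e"
proof -
  interpret dynamical_set \<Lambda> G \<phi> by fact
  have "\<exists>!b. b \<in> G \<and> circ l a b = e \<and> circ (\<phi> l a) b a = e" if l: "l \<in> \<Lambda>" and a: "a \<in> G" for l a
  proof -
    have m: "\<phi> l a \<in> \<Lambda>" using l a by (rule structure_map_closed)
    obtain b where b: "b \<in> G" "circ l a b = e" using right_inverse l a by blast
    obtain c where c: "c \<in> G" "circ (\<phi> l a) b c = e" using right_inverse m b by blast
    have "c = a"
      using assoc[OF l a b(1) c(1)] b(2) c left[OF l c(1)] right[OF l a] by simp
    then have ba: "circ (\<phi> l a) b a = e" using c by simp
    have source_back: "\<phi> (\<phi> l a) b = l" using map[OF l a b(1)] b(2) map_unit[OF l] by simp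
    \<comment> \<open>Uniqueness needs only the right inverse equation of \<open>b'\<close>: at
      \<open>\<phi> l a\<close>,
      \<open>b' = (b \<circ> a) \<circ> b' = b \<circ> (a \<circ> b') = b\<close>.\<close>
    have "b' = b" if b': "b' \<in> G" "circ l a b' = e" for b'
      using assoc[OF m b(1) a b'(1)] source_back ba b'(2) left[OF m b'(1)] right[OF m b(1)] by simp
    then show ?thesis using b ba by blast
  qed
  then show ?thesis
    by unfold_locales (use closed map assoc unit right left map_unit in auto)
qed

section \<open>The sub-adjacent dynamical group\<close>

locale structure_compatible_post_group = dynamical_post_group +
  assumes compatible: "structure_map_compatible \<Lambda> G \<phi> (sub_adjacent dot tri) e"
begin

text \<open>The action of \<open>a\<close> is a homomorphism from the group at
  \<open>\<phi> l a\<close> to the group at \<open>l\<close>. Both groups have the unit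
  \<open>e\<close>, so the image of \<open>e\<close> is idempotent and hence equals
  \<open>e\<close>.\<close>

lemma tri_unit_right:
  assumes "l \<in> \<Lambda>" "a \<in> G"
  shows "tri l a e = e"
proof -
  have m: "\<phi> l a \<in> \<Lambda>" using assms by (rule structure_map_closed)
  have t: "tri l a e \<in> G" using assms by (simp add: tri_closed const.unit_closed)
  have "dot l (tri l a e) (tri l a e) = tri l a e"
    using tri_dot[OF assms, of e e] m by (simp add: const.unit_closed const.circ_unit_right)
  also have "\<dots> = dot l (tri l a e) e" using assms t by (simp add: const.circ_unit_right)
  finally show ?thesis
    using const.circ_left_cancel[OF assms(1) t t const.unit_closed] by simp
qed

lemma structure_map_unit: "l \<in> \<Lambda> \<Longrightarrow> \<phi> l e = l"
  using compatible by (simp add: structure_map_compatible_def)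

text \<open>Weighted associativity for the pair \<open>e\<close>, \<open>e\<close> makes the action
  of \<open>e\<close> idempotent; \<open>\<phi> l e = l\<close> is what keeps both factors at the
  same parameter. An injective idempotent map is the identity.\<close>

lemma tri_unit_left:
  assumes "l \<in> \<Lambda>" "a \<in> G"
  shows "tri l e a = a"
proof -
  have e: "e \<in> G" by (rule const.unit_closed)
  have "tri l e (tri l e a) = tri l e a"
    using tri_weighted_assoc[OF assms(1) e e assms(2)] assms
    by (simp add: tri_unit_right e const.circ_unit_right structure_map_unit)
  then show ?thesis
    using bij_betw_imp_inj_on[OF tri_invertible[OF assms(1) e]] assms e
    by (meson inj_onD tri_closed)
qed

sublocale sub: dynamical_group \<Lambda> G \<phi> "sub_adjacent dot tri" e
proof (rule dynamical_groupI_right_inverse)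
  show "dynamical_set \<Lambda> G \<phi>" by unfold_locales
  show "sub_adjacent dot tri l a b \<in> G" if "l \<in> \<Lambda>" "a \<in> G" "b \<in> G" for l a b
    using that by (simp add: sub_adjacent_def const.circ_closed tri_closed)
  show "\<phi> l (sub_adjacent dot tri l a b) = \<phi> (\<phi> l a) b" if "l \<in> \<Lambda>" "a \<in> G" "b \<in> G" for l a b
    using that compatible by (simp add: structure_map_compatible_def)
  \<comment> \<open>Both sides expand to the product of \<open>a\<close>, \<open>a \<rhd> b\<close>
    and \<open>a \<rhd> (b \<rhd> c)\<close> in the group at \<open>l\<close>.\<close>
  show "sub_adjacent dot tri l a (sub_adjacent dot tri (\<phi> l a) b c) =
      sub_adjacent dot tri l (sub_adjacent dot tri l a b) c"
    if "l \<in> \<Lambda>" "a \<in> G" "b \<in> G" "c \<in> G" for l a b c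
    using that
    by (simp add: sub_adjacent_def tri_dot tri_weighted_assoc const.circ_assoc tri_closed
        structure_map_closed)
  show "e \<in> G" by (rule const.unit_closed)
  show "sub_adjacent dot tri l a e = a" if "l \<in> \<Lambda>" "a \<in> G" for l a
    using that by (simp add: sub_adjacent_def tri_unit_right const.circ_unit_right)
  show "sub_adjacent dot tri l e a = a" if "l \<in> \<Lambda>" "a \<in> G" for l a
    using that by (simp add: sub_adjacent_def tri_unit_left const.circ_unit_left)
  show "\<phi> l e = l" if "l \<in> \<Lambda>" for l using that by (rule structure_map_unit)
  show "\<exists>b\<in>G. sub_adjacent dot tri l a b = e" if "l \<in> \<Lambda>" "a \<in> G" for l a
  proof -
    \<comment> \<open>The right inverse is the preimage \<open>b\<close> under the action of
      \<open>a\<close> of the inverse of \<open>a\<close> for \<open>dot l\<close>, so that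
      \<open>a \<rhd> b\<close> cancels \<open>a\<close>.\<close>
    have "dynamical_inverse G (\<lambda>l x. l) dot e l a \<in> tri l a ` G"
      using const.dynamical_inverse_closed[OF that] bij_betw_imp_surj_on[OF tri_invertible[OF that]]
      by simp
    then show ?thesis
      using const.circ_inverse_right[OF that] by (auto simp: sub_adjacent_def)
  qed
qed

section \<open>The braiding and the identities of its two actions\<close>

abbreviation circ where "circ \<equiv> sub_adjacent dot tri"
abbreviation braiding where "braiding \<equiv> post_group_braiding G \<phi> dot e tri"

lemma lharp_braiding [simp]: "lharp braiding l a b = tri l a b"
  by (simp add: post_group_braiding_def)

lemma rharp_braiding_closed:
  assumes "l \<in> \<Lambda>" "a \<in> G" "b \<in> G"
  shows "rharp braiding l a b \<in> G"
  using assms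
  by (simp add: post_group_braiding_def sub.circ_closed sub.dynamical_inverse tri_closed
      structure_map_closed)

text \<open>Braided commutativity holds by construction, since the second component is the solution
  of this equation.\<close>

lemma circ_rharp_braiding:
  assumes "l \<in> \<Lambda>" "a \<in> G" "b \<in> G"
  shows "circ l (tri l a b) (rharp braiding l a b) = circ l a b"
  using assms
  by (simp add: post_group_braiding_def sub.circ_inverse_solves sub.circ_closed tri_closed)

lemma rharp_braiding_unique:
  assumes "l \<in> \<Lambda>" "a \<in> G" "b \<in> G" "r \<in> G" "circ l (tri l a b) r = circ l a b"
  shows "rharp braiding l a b = r"
  by (rule sub.circ_left_cancel[of l "tri l a b"])
    (use assms in \<open>simp_all add: tri_closed rharp_braiding_closed circ_rharp_braiding\<close>)

lemma tri_circ_left: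
  assumes "l \<in> \<Lambda>" "a \<in> G" "b \<in> G" "x \<in> G"
  shows "tri l (circ l a b) x = tri l a (tri (\<phi> l a) b x)"
  using assms by (simp add: sub_adjacent_def tri_weighted_assoc)

lemma tri_circ_right:
  assumes l: "l \<in> \<Lambda>" and a: "a \<in> G" and x: "x \<in> G" and y: "y \<in> G"
  shows "tri l a (circ (\<phi> l a) x y) =
    circ l (tri l a x) (tri (\<phi> l (tri l a x)) (rharp braiding l a x) y)"
proof -
  have m: "\<phi> l a \<in> \<Lambda>" using l a by (rule structure_map_closed)
  have t: "tri l a x \<in> G" and r: "rharp braiding l a x \<in> G"
    using l a x by (auto simp: tri_closed rharp_braiding_closed)
  have "tri l a (circ (\<phi> l a) x y) = dot l (tri l a x) (tri l (circ l a x) y)"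
    using l a x y m by (simp add: sub_adjacent_def tri_dot tri_closed tri_weighted_assoc)
  also have "tri l (circ l a x) y = tri l (circ l (tri l a x) (rharp braiding l a x)) y"
    using l a x by (simp only: circ_rharp_braiding)
  also have "\<dots> = tri l (tri l a x) (tri (\<phi> l (tri l a x)) (rharp braiding l a x) y)"
    using l t r y by (rule tri_circ_left)
  finally show ?thesis by (simp only: sub_adjacent_def)
qed

text \<open>With \<open>t = a \<rhd> x\<close> and \<open>r = a \<leftharpoonup> x\<close>, the left
  action on \<open>x \<circ> y\<close> is \<open>t \<circ> (r \<rhd> y)\<close>. Composing it with
  \<open>r \<leftharpoonup> y\<close> gives \<open>t \<circ> (r \<circ> y) = (t \<circ> r) \<circ> y
  = (a \<circ> x) \<circ> y\<close>, by two uses of braided commutativity.\<close>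

lemma rharp_braiding_circ_right:
  assumes l: "l \<in> \<Lambda>" and a: "a \<in> G" and x: "x \<in> G" and y: "y \<in> G"
  shows "rharp braiding l a (circ (\<phi> l a) x y) =
    rharp braiding (\<phi> l (tri l a x)) (rharp braiding l a x) y"
proof -
  define t r n where "t = tri l a x" and "r = rharp braiding l a x" and "n = \<phi> l t"
  have m: "\<phi> l a \<in> \<Lambda>" using l a by (rule structure_map_closed)
  have t: "t \<in> G" and r: "r \<in> G"
    using l a x by (auto simp: t_def r_def tri_closed rharp_braiding_closed)
  have n: "n \<in> \<Lambda>" unfolding n_def using l t by (rule structure_map_closed)
  have "circ l (tri l a (circ (\<phi> l a) x y)) (rharp braiding n r y) =
      circ l (circ l t (tri n r y)) (rharp braiding n r y)"
    using tri_circ_right[OF assms] by (simp only: t_def r_def n_def)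
  also have "\<dots> = circ l t (circ n (tri n r y) (rharp braiding n r y))"
    using l t n r y sub.circ_assoc[of l t "tri n r y" "rharp braiding n r y"]
    by (simp add: n_def[symmetric] tri_closed rharp_braiding_closed)
  also have "\<dots> = circ l (circ l t r) y"
    using l t n r y sub.circ_assoc[of l t r y] by (simp add: n_def[symmetric] circ_rharp_braiding)
  also have "\<dots> = circ l a (circ (\<phi> l a) x y)"
    using l a x y by (simp add: t_def r_def circ_rharp_braiding sub.circ_assoc)
  finally show ?thesis
    using rharp_braiding_unique[of l a "circ (\<phi> l a) x y" "rharp braiding n r y"] l a m x y n r
    by (simp add: t_def r_def n_def sub.circ_closed rharp_braiding_closed)
qed

text \<open>With \<open>y = b \<rhd> x\<close>, the left action of \<open>a \<circ> b\<close> on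
  \<open>x\<close> is \<open>a \<rhd> y\<close>. Composing it with the claimed value, braided
  commutativity for \<open>a\<close>, \<open>y\<close> and then for \<open>b\<close>,
  \<open>x\<close> leads to \<open>a \<circ> (b \<circ> x)\<close>.\<close>

lemma rharp_braiding_circ_left:
  assumes l: "l \<in> \<Lambda>" and a: "a \<in> G" and b: "b \<in> G" and x: "x \<in> G"
  shows "rharp braiding l (circ l a b) x =
    circ (\<phi> l (tri l (circ l a b) x))
      (rharp braiding l a (tri (\<phi> l a) b x)) (rharp braiding (\<phi> l a) b x)"
proof -
  define m y where "m = \<phi> l a" and "y = tri m b x"
  define s q where "s = rharp braiding l a y" and "q = rharp braiding m b x"
  have m: "m \<in> \<Lambda>" unfolding m_def using l a by (rule structure_map_closed)
  have y: "y \<in> G" using m b x by (simp add: y_def tri_closed)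
  have s: "s \<in> G" and q: "q \<in> G"
    using l a m b x y by (auto simp: s_def q_def rharp_braiding_closed)
  have t: "tri l a y \<in> G" using l a y by (rule tri_closed)
  have n: "\<phi> l (tri l a y) \<in> \<Lambda>" using l t by (rule structure_map_closed)
  have eq: "tri l (circ l a b) x = tri l a y"
    using tri_circ_left[OF assms] by (simp add: y_def m_def)
  have "circ l (tri l a y) (circ (\<phi> l (tri l a y)) s q) = circ l (circ l (tri l a y) s) q"
    using l t s q by (rule sub.circ_assoc)
  also have "\<dots> = circ l (circ l a y) q"
    using l a y by (simp add: s_def circ_rharp_braiding)
  also have "\<dots> = circ l a (circ m y q)"
    using sub.circ_assoc[OF l a y q] by (simp add: m_def)
  also have "\<dots> = circ l a (circ m b x)"
    using m b x by (simp add: y_def q_def circ_rharp_braiding)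
  also have "\<dots> = circ l (circ l a b) x"
    using sub.circ_assoc[OF assms] by (simp add: m_def)
  finally have "rharp braiding l (circ l a b) x = circ (\<phi> l (tri l a y)) s q"
    using l a b x s q n
    by (intro rharp_braiding_unique) (simp_all add: sub.circ_closed eq)
  then show ?thesis by (simp only: eq s_def q_def y_def m_def)
qed

sublocale braided: braided_dynamical_group \<Lambda> G \<phi> "sub_adjacent dot tri" e
  "post_group_braiding G \<phi> dot e tri"
proof unfold_locales
  show "tensor_structure_map \<phi> \<phi> l p \<in> \<Lambda>" if "l \<in> \<Lambda>" "p \<in> G \<times> G" for l p
    using that by (auto simp: tensor_structure_map_def structure_map_closed)
  show "braiding l p \<in> G \<times> G" if "l \<in> \<Lambda>" "p \<in> G \<times> G" for l p
    using that rharp_braiding_closed[of l "fst p" "snd p"] lharp_braiding[of l "fst p" "snd p"]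
    by (auto simp: mem_Times_iff tri_closed)
  show "tensor_structure_map \<phi> \<phi> l (braiding l p) = tensor_structure_map \<phi> \<phi> l p"
    if "l \<in> \<Lambda>" "p \<in> G \<times> G" for l p
  proof -
    obtain a b where p: "p = (a, b)" "a \<in> G" "b \<in> G" using \<open>p \<in> G \<times> G\<close> by (rule SigmaE)
    \<comment> \<open>The structure map is applied to both sides of braided commutativity.\<close>
    have "\<phi> (\<phi> l (tri l a b)) (rharp braiding l a b) = \<phi> (\<phi> l a) b"
      using that p sub.structure_map_circ[of l "tri l a b" "rharp braiding l a b"]
      by (simp add: circ_rharp_braiding rharp_braiding_closed tri_closed sub.structure_map_circ)
    then show ?thesis by (simp add: p tensor_structure_map_def case_prod_unfold)
  qed
  \<comment> \<open>Since \<open>a \<rhd> e = e\<close>, the characterizing equation reads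
    \<open>e \<circ> a = a \<circ> e\<close>.\<close>
  show "rharp braiding l a e = a" if "l \<in> \<Lambda>" "a \<in> G" for l a
    using that
    by (intro rharp_braiding_unique)
      (simp_all add: tri_unit_right sub.unit_closed sub.circ_unit_left sub.circ_unit_right)
qed (simp_all add: tri_unit_left tri_circ_left tri_circ_right circ_rharp_braiding
    rharp_braiding_circ_right rharp_braiding_circ_left)

end

section \<open>The braided dynamical group and its functoriality\<close>

theorem theorem4p11:
  fixes \<Lambda> :: "'l set"
    and G :: "'g set" and \<phi> :: "'l \<Rightarrow> 'g \<Rightarrow> 'l" and e :: 'g
    and dot tri :: "'l \<Rightarrow> 'g \<Rightarrow> 'g \<Rightarrow> 'g"
  assumes "dynamical_post_group \<Lambda> G \<phi> dot e tri"
    and "structure_map_compatible \<Lambda> G \<phi> (sub_adjacent dot tri) e"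
  shows "braided_dynamical_group \<Lambda> G \<phi> (sub_adjacent dot tri) e (post_group_braiding G \<phi> dot e tri)
    \<and> (\<forall>(H :: 'h set) \<phi>' dot' e' tri' \<Psi>.
          structure_map_compatible \<Lambda> H \<phi>' (sub_adjacent dot' tri') e' \<longrightarrow>
          dynamical_post_group_hom \<Lambda> G \<phi> dot e tri H \<phi>' dot' e' tri' \<Psi> \<longrightarrow>
          braided_dynamical_group_hom \<Lambda>
            G \<phi> (sub_adjacent dot tri) e (post_group_braiding G \<phi> dot e tri)
            H \<phi>' (sub_adjacent dot' tri') e' (post_group_braiding H \<phi>' dot' e' tri') \<Psi>)"
proof (intro conjI allI impI)
  interpret S: structure_compatible_post_group \<Lambda> G \<phi> dot e tri
    using assms
    by (intro structure_compatible_post_group.intro structure_compatible_post_group_axioms.intro)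
  show "braided_dynamical_group \<Lambda> G \<phi> (sub_adjacent dot tri) e (post_group_braiding G \<phi> dot e tri)"
    by (rule S.braided.braided_dynamical_group_axioms)
  fix H :: "'h set" and \<phi>' dot' e' tri' \<Psi>
  assume compat': "structure_map_compatible \<Lambda> H \<phi>' (sub_adjacent dot' tri') e'"
    and hom: "dynamical_post_group_hom \<Lambda> G \<phi> dot e tri H \<phi>' dot' e' tri' \<Psi>"
  interpret P: dynamical_post_group_hom \<Lambda> G \<phi> dot e tri H \<phi>' dot' e' tri' \<Psi> by (rule hom)
  interpret T: structure_compatible_post_group \<Lambda> H \<phi>' dot' e' tri'
    by unfold_locales (rule compat')
  have hom_circ: "\<Psi> l (S.circ l a b) = T.circ l (\<Psi> l a) (\<Psi> (\<phi> l a) b)"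
    if "l \<in> \<Lambda>" "a \<in> G" "b \<in> G" for l a b
    using that by (simp add: sub_adjacent_def P.hom_dot P.hom_tri S.tri_closed)
  \<comment> \<open>Applying \<open>\<Psi>\<close> to braided commutativity in \<open>G\<close>
    shows that the image of the right action solves the equation characterizing the right action in
    \<open>H\<close>.\<close>
  have hom_rharp: "rharp T.braiding l (\<Psi> l a) (\<Psi> (\<phi> l a) b) =
      \<Psi> (\<phi> l (tri l a b)) (rharp S.braiding l a b)"
    if l: "l \<in> \<Lambda>" and a: "a \<in> G" and b: "b \<in> G" for l a b
  proof (rule T.rharp_braiding_unique)
    have t: "tri l a b \<in> G" and r: "rharp S.braiding l a b \<in> G"
      using that by (auto simp: S.tri_closed S.rharp_braiding_closed)
    show "T.circ l (tri' l (\<Psi> l a) (\<Psi> (\<phi> l a) b)) (\<Psi> (\<phi> l (tri l a b)) (rharp S.braiding l a b)) =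
        T.circ l (\<Psi> l a) (\<Psi> (\<phi> l a) b)"
      using hom_circ[OF l t r] that by (simp add: S.circ_rharp_braiding hom_circ P.hom_tri)
    show "\<Psi> (\<phi> l (tri l a b)) (rharp S.braiding l a b) \<in> H"
      using l t r by (simp add: P.morphism_closed S.structure_map_closed)
  qed (use that in \<open>simp_all add: P.morphism_closed S.structure_map_closed\<close>)
  show "braided_dynamical_group_hom \<Lambda> G \<phi> S.circ e S.braiding H \<phi>' T.circ e' T.braiding \<Psi>"
  proof unfold_locales
    show "tensor_square_map \<phi> \<Psi> l (S.braiding l p) = T.braiding l (tensor_square_map \<phi> \<Psi> l p)"
      if "l \<in> \<Lambda>" "p \<in> G \<times> G" for l p
      using that
      by (auto simp: tensor_square_map_def case_prod_unfold prod_eq_iff P.hom_tri hom_rharp)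
  qed (rule hom_circ)
qed

end
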